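(* Let $d\ge1$, let $I,V\in C^2(\mathbb R^d,\mathbb R)$, and assume that $\nabla V:\mathbb R^d\to\mathbb R^d$ satisfies the Aubry criterion with parameters $O\subset\mathbb R^d$, $R>0$, $r>0$, $m>0$. Let $\rho\in\mathrm{Hom}(\mathbb Z,\mathbb R^d)$, put $$K(\rho,r+R):=4\sup_{x\in B_{\|\rho\|+2(R+r)}(0)}\sigma_{\max}(\nabla^2I(x)),$$ and let $\lambda\in\mathbb R$ satisfy $\lambda\ge\frac{r+R}{rm}K(\rho,r+R)$. Assume that for some $M>0$, $$\sup_{x:\ d(x,\rho)\le r+R}\ \sup_{n\in\mathbb Z}\sigma_{\max}(\nabla^2V(x_n))\le M,$$ where the outer supremum is over configurations $x=(x_n)_{n\in\mathbb Z}$, $x_n\in\mathbb R^d$. Let $u=(u_n)_{n\in\mathbb Z}$, $u_n\in\mathbb R^d$, be the equilibrium configuration of the energy $\Phi(u)=\sum_{n\in\mathbb Z}\left[I(u_n-u_{n+1})+\lambda V(u_n)\right]$ provided by the anti-integrable limit theorem recalled in the context, so that $u$ satisfies (1) $\sup_{n\in\mathbb Z}\inf_{z\in O}\|u_n-z\|\le r$ and $d(u,\rho)\le r+R$; (2) $\sigma_{\max}(\nabla^2I(u_n-u_{n+1}))\le\frac{K(\rho,r+R)}{4}$ for all $n\in\mathbb Z$; (3) $\sigma_{\min}(\nabla^2V(u_n))\ge m>0$ for all $n\in\mathbb Z$. Then $u$ has a phonon gap, i.e. $0\notin\sigma(D^2\Phi(u))$. Moreover, its gap parameter satisfies $$G(u)\ge\frac{\lambda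 m-K(\rho,r+R)}{\lambda M+K(\rho,r+R)}.$$
   Context: Norms and notation. $\|\cdot\|$ is the Euclidean norm on $\mathbb R^d$; $B_s(z)$ and $\overline B_s(z)$ are the open and closed balls of radius $s$ centered at $z$. For a matrix $A$, $\sigma_{\max}(A)$ and $\sigma_{\min}(A)$ are its largest and smallest singular values. $\nabla^2$ denotes the Hessian matrix. A homomorphism $\rho\in\mathrm{Hom}(\mathbb Z,\mathbb R^d)$ is $\rho(n)=n\rho(1)$, with $\|\rho\|=\|\rho(1)\|$. For a configuration $x=(x_n)_{n\in\mathbb Z}$, $x_n\in\mathbb R^d$, $d(x,\rho)=\sup_{n\in\mathbb Z}\|x_n-\rho(n)\|$. Aubry criterion. A continuous $\psi:\mathbb R^d\to\mathbb R^d$ satisfies the Aubry criterion with parameters $O\subset\mathbb R^d$, $R,r,m>0$ if: (i) every ball of radius $R$ contains at least one point of $O$; (ii) $\psi(z)=0$ for all $z\in O$; (iii) $\|\psi(x)-\psi(y)\|\ge m\|x-y\|$ for all $z\in O$ and all $x,y\in\overline B_r(z)$. Equilibria. With $L(x,y)=I(x-y)+\lambda V(x)$, a configuration $u$ is an equilibrium if $D_1L(u_n,u_{n+1})+D_2L(u_{n-1},u_n)=0$ for all $n\in\mathbb Z$, i.e. $\nabla I(u_n-u_{n+1})-\nabla I(u_{n-1}-u_n)+\lambda\nabla V(u_n)=0$. Anti-integrable limit theorem (quoted from earlier work). Under the hypotheses on $I,V,\rho,\lambda$ in the claim (without the assumption involving $M$), there exists an equilibrium configuration $u$ with properties (1)–(3)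 of the claim; moreover it is unique in the sense that if $u'$ is also an equilibrium configuration and for every $i\in\mathbb Z$ there is $x\in O$ with $u_i,u_i'\in\overline B_r(x)$, then $u=u'$. Hessian operator. For an equilibrium $u$, $D^2\Phi(u)$ acts on $\ell^2$, the space of square-summable sequences $\xi=(\xi_n)_{n\in\mathbb Z}$ with $\xi_n\in\mathbb R^d$ (complexified when speaking of spectrum), by $$(D^2\Phi(u)\xi)_n=-\nabla^2I(u_{n-1}-u_n)\xi_{n-1}+\left(\nabla^2I(u_n-u_{n+1})+\nabla^2I(u_{n-1}-u_n)+\lambda\nabla^2V(u_n)\right)\xi_n-\nabla^2I(u_n-u_{n+1})\xi_{n+1}.$$ Phonon gap and gap parameter. For a bounded operator $A$ on $\ell^2$ with spectrum $\sigma(A)$, $\sigma_{\max}(A)=\sup\{|E|:E\in\sigma(A)\}$ and $\sigma_{\min}(A)=\inf\{|E|:E\in\sigma(A)\}$. The equilibrium $u$ has a phonon gap if $0\notin\sigma(D^2\Phi(u))$, i.e. $D^2\Phi(u)$ is invertible on $\ell^2$. The gap parameter is $G(u)=\sigma_{\min}(D^2\Phi(u))/\sigma_{\max}(D^2\Phi(u))$.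
   Formalization: The formal statement adds the hypothesis λ ≠ 0; for λ = 0 (possible only if K = 0) one has D²Φ(u) = 0 with spectrum {0}, so there is no phonon gap and the claim fails (e.g. I = 0, λ = 0). *)

theory Defs
  imports "HOL-Analysis.Analysis"
begin

section \<open>Gradient, Hessian, singular values\<close>

definition grad :: "('a::real_inner \<Rightarrow> real) \<Rightarrow> 'a \<Rightarrow> 'a" where
  "grad f x = (THE D. GDERIV f x :> D)"

definition hess :: "(real^'d \<Rightarrow> real) \<Rightarrow> real^'d \<Rightarrow> real^'d^'d" where
  "hess f x = jacobian (grad f) (at x)"

definition C2 :: "(real^'d \<Rightarrow> real) \<Rightarrow> bool" where
  "C2 f \<longleftrightarrow> (\<forall>x. f differentiable (at x)) \<and> (\<forall>x. grad f differentiable (at x)) \<and>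
     continuous_on UNIV (hess f)"

definition singular_values :: "real^'d^'d \<Rightarrow> real set" where
  "singular_values A =
     {s. 0 \<le> s \<and> (\<exists>v. v \<noteq> 0 \<and> (transpose A ** A) *v v = s\<^sup>2 *\<^sub>R v)}"

definition sigma_max :: "real^'d^'d \<Rightarrow> real" where
  "sigma_max A = Max (singular_values A)"

definition sigma_min :: "real^'d^'d \<Rightarrow> real" where
  "sigma_min A = Min (singular_values A)"


section \<open>Aubry criterion, configurations, equilibria\<close>

text \<open>
  The balls in the first clause are read as closed balls, which is the weaker requirement.
\<close>

definition aubry_criterion ::
  "('a::euclidean_space \<Rightarrow> 'a) \<Rightarrow> 'a set \<Rightarrow> real \<Rightarrow> real \<Rightarrow> real \<Rightarrow> bool" where
  "aubry_criterion \<psi> Z R r m \<longleftrightarrow>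
     R > 0 \<and> r > 0 \<and> m > 0 \<and> continuous_on UNIV \<psi> \<and>
     (\<forall>x. \<exists>z\<in>Z. z \<in> cball x R) \<and>
     (\<forall>z\<in>Z. \<psi> z = 0) \<and>
     (\<forall>z\<in>Z. \<forall>x\<in>cball z r. \<forall>y\<in>cball z r. norm (\<psi> x - \<psi> y) \<ge> m * norm (x - y))"

text \<open>
  Extended reals, because the supremum is infinite for some configurations.
\<close>

definition config_dist ::
  "(int \<Rightarrow> 'a::real_normed_vector) \<Rightarrow> (int \<Rightarrow> 'a) \<Rightarrow> ereal" where
  "config_dist x \<rho> = (SUP n. ereal (norm (x n - \<rho> n)))"

text \<open>
  The parameter \<open>s\<close> stands for \<open>r + R\<close>.  For \<open>I\<close> of class C2 the supremum is that of a
  continuous function over a bounded set, hence finite.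
\<close>

definition K_const :: "(real^'d \<Rightarrow> real) \<Rightarrow> (int \<Rightarrow> real^'d) \<Rightarrow> real \<Rightarrow> real" where
  "K_const I \<rho> s = 4 * (SUP x\<in>ball 0 (norm (\<rho> 1) + 2 * s). sigma_max (hess I x))"

definition lagr ::
  "('a::real_inner \<Rightarrow> real) \<Rightarrow> ('a \<Rightarrow> real) \<Rightarrow> real \<Rightarrow> 'a \<Rightarrow> 'a \<Rightarrow> real" where
  "lagr I V lam x y = I (x - y) + lam * V x"

definition equilibrium ::
  "('a::real_inner \<Rightarrow> real) \<Rightarrow> ('a \<Rightarrow> real) \<Rightarrow> real \<Rightarrow> (int \<Rightarrow> 'a) \<Rightarrow> bool" where
  "equilibrium I V lam u \<longleftrightarrow>
     (\<forall>n. grad (\<lambda>x. lagr I V lam x (u (n + 1))) (u n)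
        + grad (\<lambda>y. lagr I V lam (u (n - 1)) y) (u n) = 0)"


section \<open>Operators on square-summable sequences and their spectrum\<close>

definition ell2 :: "(int \<Rightarrow> 'a::real_normed_vector) set" where
  "ell2 = {\<xi>. (\<lambda>n. (norm (\<xi> n))\<^sup>2) summable_on UNIV}"

definition ell2_norm :: "(int \<Rightarrow> 'a::real_normed_vector) \<Rightarrow> real" where
  "ell2_norm \<xi> = sqrt (\<Sum>\<^sub>\<infinity>n. (norm (\<xi> n))\<^sup>2)"

text \<open>
  Operators are functions on all sequences; only their restriction to \<^term>\<open>ell2\<close> matters.
\<close>

definition bounded_ell2_operator ::
  "((int \<Rightarrow> complex^'d) \<Rightarrow> (int \<Rightarrow> complex^'d)) \<Rightarrow> bool" where
  "bounded_ell2_operator A \<longleftrightarrow>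
     (\<forall>\<xi>\<in>ell2. A \<xi> \<in> ell2) \<and>
     (\<forall>\<xi>\<in>ell2. \<forall>\<eta>\<in>ell2. A (\<lambda>n. \<xi> n + \<eta> n) = (\<lambda>n. A \<xi> n + A \<eta> n)) \<and>
     (\<forall>c. \<forall>\<xi>\<in>ell2. A (\<lambda>n. c *s \<xi> n) = (\<lambda>n. c *s A \<xi> n)) \<and>
     (\<exists>C. \<forall>\<xi>\<in>ell2. ell2_norm (A \<xi>) \<le> C * ell2_norm \<xi>)"

definition ell2_invertible ::
  "((int \<Rightarrow> complex^'d) \<Rightarrow> (int \<Rightarrow> complex^'d)) \<Rightarrow> bool" where
  "ell2_invertible A \<longleftrightarrow>
     (\<forall>\<xi>\<in>ell2. A \<xi> \<in> ell2) \<and>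
     (\<exists>B. bounded_ell2_operator B \<and> (\<forall>\<xi>\<in>ell2. B (A \<xi>) = \<xi> \<and> A (B \<xi>) = \<xi>))"

definition ell2_spectrum ::
  "((int \<Rightarrow> complex^'d) \<Rightarrow> (int \<Rightarrow> complex^'d)) \<Rightarrow> complex set" where
  "ell2_spectrum A = {E. \<not> ell2_invertible (\<lambda>\<xi> n. A \<xi> n - E *s \<xi> n)}"

definition spec_max ::
  "((int \<Rightarrow> complex^'d) \<Rightarrow> (int \<Rightarrow> complex^'d)) \<Rightarrow> real" where
  "spec_max A = (SUP E\<in>ell2_spectrum A. cmod E)"

definition spec_min ::
  "((int \<Rightarrow> complex^'d) \<Rightarrow> (int \<Rightarrow> complex^'d)) \<Rightarrow> real" where
  "spec_min A = (INF E\<in>ell2_spectrum A. cmod E)"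

text \<open>
  The complex-linear extension of a real operator: \<open>A (a + i b) = A a + i A b\<close>, with real and
  imaginary parts taken componentwise.
\<close>

definition complexify ::
  "((int \<Rightarrow> real^'d) \<Rightarrow> (int \<Rightarrow> real^'d)) \<Rightarrow> (int \<Rightarrow> complex^'d) \<Rightarrow> (int \<Rightarrow> complex^'d)" where
  "complexify A \<xi> =
     (\<lambda>n. \<chi> j. Complex (A (\<lambda>k. \<chi> i. Re (\<xi> k $ i)) n $ j)
                       (A (\<lambda>k. \<chi> i. Im (\<xi> k $ i)) n $ j))"


section \<open>Hessian operator, phonon gap, gap parameter\<close>

definition hess_op ::
  "(real^'d \<Rightarrow> real) \<Rightarrow> (real^'d \<Rightarrow> real) \<Rightarrow> real \<Rightarrow> (int \<Rightarrow> real^'d)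
     \<Rightarrow> (int \<Rightarrow> real^'d) \<Rightarrow> (int \<Rightarrow> real^'d)" where
  "hess_op I V lam u \<xi> = (\<lambda>n.
     - (hess I (u (n - 1) - u n) *v \<xi> (n - 1))
     + (hess I (u n - u (n + 1)) + hess I (u (n - 1) - u n) + lam *\<^sub>R hess V (u n)) *v \<xi> n
     - hess I (u n - u (n + 1)) *v \<xi> (n + 1))"

definition phonon_gap ::
  "(real^'d \<Rightarrow> real) \<Rightarrow> (real^'d \<Rightarrow> real) \<Rightarrow> real \<Rightarrow> (int \<Rightarrow> real^'d) \<Rightarrow> bool" where
  "phonon_gap I V lam u \<longleftrightarrow> 0 \<notin> ell2_spectrum (complexify (hess_op I V lam u))"

definition gap_parameter ::
  "(real^'d \<Rightarrow> real) \<Rightarrow> (real^'d \<Rightarrow> real) \<Rightarrow> real \<Rightarrow> (int \<Rightarrow> real^'d) \<Rightarrow> real" where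
  "gap_parameter I V lam u =
     spec_min (complexify (hess_op I V lam u)) / spec_max (complexify (hess_op I V lam u))"

end

theory Submission
  imports Defs "HOL-Complex_Analysis.Cauchy_Integral_Formula"
begin

text \<open>
  Split the complexified Hessian operator into its on-site part \<open>D\<close>, the block diagonal operator
  with blocks \<open>lam *\<^sub>R hess V (u n)\<close>, and the coupling part \<open>B\<close> that comes from \<open>I\<close>, and write \<open>K\<close>
  for \<open>K_const I \<rho> (r + R)\<close>.  The bounds on the singular values of \<open>hess V (u n)\<close> say that \<open>D\<close>
  stretches every sequence by a factor between \<open>lam * m\<close> and \<open>lam * M\<close>, and they make \<open>D\<close>
  invertible block by block.  At each site \<open>B\<close> has four terms, each with a matrix of norm at most
  \<open>K / 4\<close>, so the norm of \<open>B\<close> is at most \<open>K\<close>.  The lower bound on \<open>lam\<close> gives \<open>K < lam * m\<close>.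

  If \<open>\<bar>E\<bar> < lam * m - K\<close>, then \<open>D\<close> dominates \<open>B - E\<close> and \<open>D + B - E\<close> is invertible; if
  \<open>\<bar>E\<bar> > lam * M + K\<close>, then \<open>- E\<close> dominates \<open>D + B\<close> and the same conclusion holds
  (\<open>ell2_invertible_perturbation\<close>, which rests on completeness of the sequence space and Banach's
  fixed point theorem).  So the spectrum lies in the annulus between these two radii
  (\<open>ell2_spectrum_in_annulus\<close>).  This excludes 0, which is the phonon gap.

  The annulus bounds the extremal moduli of the spectrum, and hence their quotient, once the
  spectrum is known to contain a point.  This is the second ingredient
  (\<open>ell2_spectrum_nonempty\<close>): by Liouville's theorem a bounded operator cannot have a resolvent on the
  whole complex plane.
\<close>

section \<open>The Banach space of square-summable sequences\<close>

lemma ell2_norm_nonneg [simp]: "0 \<le> ell2_norm \<xi>"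
  by (simp add: ell2_norm_def infsum_nonneg)

text \<open>
  This lemma and \<open>L2_set_le_ell2_norm\<close> below replace infinite sums by uniform bounds on finite
  sections, where Minkowski's inequality and passage to pointwise limits are elementary.
\<close>
lemma ell2_normI:
  assumes "\<And>F. finite F \<Longrightarrow> L2_set (\<lambda>n. norm (\<xi> n)) F \<le> C"
  shows "\<xi> \<in> ell2" and "ell2_norm \<xi> \<le> C"
proof -
  have C: "0 \<le> C"
    using assms[of "{}"] by simp
  have fin: "(\<Sum>n\<in>F. (norm (\<xi> n))\<^sup>2) \<le> C\<^sup>2" if "finite F" for F
    using assms[OF that] by (simp add: L2_set_def sqrt_le_D)
  then have summ: "(\<lambda>n. (norm (\<xi> n))\<^sup>2) summable_on UNIV"
    by (intro nonneg_bdd_above_summable_on bdd_aboveI2[where M = "C\<^sup>2"]) auto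
  then show "\<xi> \<in> ell2"
    by (simp add: ell2_def)
  have "(\<Sum>\<^sub>\<infinity>n. (norm (\<xi> n))\<^sup>2) \<le> C\<^sup>2"
    using summ fin by (rule infsum_le_finite_sums)
  then show "ell2_norm \<xi> \<le> C"
    using C by (simp add: ell2_norm_def real_le_lsqrt infsum_nonneg)
qed

lemma L2_set_le_ell2_norm:
  assumes "\<xi> \<in> ell2" "finite F"
  shows "L2_set (\<lambda>n. norm (\<xi> n)) F \<le> ell2_norm \<xi>"
  using assms unfolding L2_set_def ell2_norm_def ell2_def
  by (auto intro!: finite_sum_le_infsum)

lemma norm_le_ell2_norm: "norm (\<xi> n) \<le> ell2_norm \<xi>" if "\<xi> \<in> ell2"
  using L2_set_le_ell2_norm[OF that, of "{n}"] by simp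

lemma ell2_norm_eq_0_iff: "ell2_norm \<xi> = 0 \<longleftrightarrow> \<xi> = (\<lambda>n. 0)" if "\<xi> \<in> ell2"
proof
  assume "ell2_norm \<xi> = 0"
  then show "\<xi> = (\<lambda>n. 0)"
    using norm_le_ell2_norm[OF that] by (auto simp: fun_eq_iff)
qed (simp add: ell2_norm_def)

text \<open>
  The index map \<open>s\<close> makes this cover both block multiplication and the shifts by one site that
  the Hessian contains.  Read with the roles of a sequence and its image exchanged, it also turns
  a pointwise lower bound on a block operator into membership and a lower bound in norm.
\<close>
lemma ell2_dominated:
  assumes "\<xi> \<in> ell2" "inj s" "0 \<le> c" "\<And>n. norm (\<eta> n) \<le> c * norm (\<xi> (s n))"
  shows "\<eta> \<in> ell2" and "ell2_norm \<eta> \<le> c * ell2_norm \<xi>"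
proof -
  have "L2_set (\<lambda>n. norm (\<eta> n)) F \<le> c * ell2_norm \<xi>" if "finite F" for F
  proof -
    have inj: "inj_on s F"
      using \<open>inj s\<close> by (auto intro: inj_on_subset)
    have "L2_set (\<lambda>n. norm (\<eta> n)) F \<le> L2_set (\<lambda>n. c * norm (\<xi> (s n))) F"
      using assms by (intro L2_set_mono) auto
    also have "\<dots> = c * L2_set (\<lambda>n. norm (\<xi> n)) (s ` F)"
      using \<open>0 \<le> c\<close> by (simp add: L2_set_right_distrib) (simp add: L2_set_def sum.reindex[OF inj])
    also have "\<dots> \<le> c * ell2_norm \<xi>"
      using assms that by (intro mult_left_mono L2_set_le_ell2_norm) auto
    finally show ?thesis .
  qed
  then show "\<eta> \<in> ell2" "ell2_norm \<eta> \<le> c * ell2_norm \<xi>"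
    by (fact ell2_normI)+
qed

lemma ell2_add:
  assumes "\<xi> \<in> ell2" "\<eta> \<in> ell2"
  shows "(\<lambda>n. \<xi> n + \<eta> n) \<in> ell2"
    and "ell2_norm (\<lambda>n. \<xi> n + \<eta> n) \<le> ell2_norm \<xi> + ell2_norm \<eta>"
proof -
  have "L2_set (\<lambda>n. norm (\<xi> n + \<eta> n)) F \<le> ell2_norm \<xi> + ell2_norm \<eta>" if "finite F" for F
  proof -
    have "L2_set (\<lambda>n. norm (\<xi> n + \<eta> n)) F \<le> L2_set (\<lambda>n. norm (\<xi> n) + norm (\<eta> n)) F"
      by (intro L2_set_mono norm_triangle_ineq) auto
    also have "\<dots> \<le> L2_set (\<lambda>n. norm (\<xi> n)) F + L2_set (\<lambda>n. norm (\<eta> n)) F"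
      by (rule L2_set_triangle_ineq)
    also have "\<dots> \<le> ell2_norm \<xi> + ell2_norm \<eta>"
      using assms that by (intro add_mono L2_set_le_ell2_norm)
    finally show ?thesis .
  qed
  then show "(\<lambda>n. \<xi> n + \<eta> n) \<in> ell2"
    "ell2_norm (\<lambda>n. \<xi> n + \<eta> n) \<le> ell2_norm \<xi> + ell2_norm \<eta>"
    by (fact ell2_normI)+
qed

lemma ell2_minus [simp]:
  "(\<lambda>n. - \<xi> n) \<in> ell2 \<longleftrightarrow> \<xi> \<in> ell2" "ell2_norm (\<lambda>n. - \<xi> n) = ell2_norm \<xi>"
  by (auto simp: ell2_def ell2_norm_def)

lemma ell2_diff:
  assumes "\<xi> \<in> ell2" "\<eta> \<in> ell2"
  shows "(\<lambda>n. \<xi> n - \<eta> n) \<in> ell2"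
    and "ell2_norm (\<lambda>n. \<xi> n - \<eta> n) \<le> ell2_norm \<xi> + ell2_norm \<eta>"
  using ell2_add[of \<xi> "\<lambda>n. - \<eta> n"] assms by simp_all

lemma ell2_norm_minus_commute: "ell2_norm (\<lambda>n. \<xi> n - \<eta> n) = ell2_norm (\<lambda>n. \<eta> n - \<xi> n)"
  by (simp add: ell2_norm_def norm_minus_commute)

lemma ell2_zero [simp]: "(\<lambda>n. 0) \<in> ell2"
  by (simp add: ell2_def)

interpretation ell2: Metric_space "ell2 :: (int \<Rightarrow> 'a::real_normed_vector) set"
  "\<lambda>\<xi> \<eta>. ell2_norm (\<lambda>n. \<xi> n - \<eta> n)"
proof
  fix \<xi> \<eta> \<zeta> :: "int \<Rightarrow> 'a"
  assume "\<xi> \<in> ell2" "\<eta> \<in> ell2" "\<zeta> \<in> ell2"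
  then show "ell2_norm (\<lambda>n. \<xi> n - \<zeta> n)
      \<le> ell2_norm (\<lambda>n. \<xi> n - \<eta> n) + ell2_norm (\<lambda>n. \<eta> n - \<zeta> n)"
    using ell2_add(2)[of "\<lambda>n. \<xi> n - \<eta> n" "\<lambda>n. \<eta> n - \<zeta> n"] by (simp add: ell2_diff(1))
next
  fix \<xi> \<eta> :: "int \<Rightarrow> 'a"
  assume "\<xi> \<in> ell2" "\<eta> \<in> ell2"
  then show "ell2_norm (\<lambda>n. \<xi> n - \<eta> n) = 0 \<longleftrightarrow> \<xi> = \<eta>"
    by (simp add: ell2_norm_eq_0_iff ell2_diff(1) fun_eq_iff)
qed (auto intro: ell2_norm_minus_commute)

text \<open>
  A Cauchy sequence converges at every site.  On a finite section the distance to the pointwise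
  limit is the limit of the distances within the sequence, so it obeys the same Cauchy bound, and
  this bound is uniform in the section.
\<close>
lemma ell2_mcomplete: "Metric_space.mcomplete ell2 (\<lambda>\<xi> \<eta> :: int \<Rightarrow> 'a::banach. ell2_norm (\<lambda>n. \<xi> n - \<eta> n))"
  unfolding ell2.mcomplete_def
proof (intro allI impI)
  fix X :: "nat \<Rightarrow> int \<Rightarrow> 'a"
  assume "ell2.MCauchy X"
  then have X: "\<And>k. X k \<in> ell2"
    and Cau: "\<And>e. e > 0 \<Longrightarrow> \<exists>N. \<forall>k l. N \<le> k \<longrightarrow> N \<le> l \<longrightarrow> ell2_norm (\<lambda>n. X k n - X l n) < e"
    unfolding ell2.MCauchy_def by auto
  have "Cauchy (\<lambda>k. X k n)" for n
  proof (rule metric_CauchyI)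
    fix e :: real
    assume "e > 0"
    then obtain N where N: "\<And>k l. N \<le> k \<Longrightarrow> N \<le> l \<Longrightarrow> ell2_norm (\<lambda>n. X k n - X l n) < e"
      using Cau by blast
    show "\<exists>N. \<forall>k\<ge>N. \<forall>l\<ge>N. dist (X k n) (X l n) < e"
    proof (intro exI allI impI)
      fix k l
      assume "N \<le> k" "N \<le> l"
      then show "dist (X k n) (X l n) < e"
        using N[of k l] norm_le_ell2_norm[OF ell2_diff(1)[OF X[of k] X[of l]], of n]
        by (simp add: dist_norm)
    qed
  qed
  then have "\<exists>y. (\<lambda>k. X k n) \<longlonglongrightarrow> y" for n
    by (simp add: Cauchy_convergent_iff convergent_def)
  then obtain x where x: "\<And>n. (\<lambda>k. X k n) \<longlonglongrightarrow> x n"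
    by metis
  have lim: "\<exists>N. \<forall>k\<ge>N. (\<lambda>n. X k n - x n) \<in> ell2 \<and> ell2_norm (\<lambda>n. X k n - x n) \<le> e"
    if "e > 0" for e
  proof -
    obtain N where N: "\<And>k l. N \<le> k \<Longrightarrow> N \<le> l \<Longrightarrow> ell2_norm (\<lambda>n. X k n - X l n) < e"
      using Cau \<open>e > 0\<close> by blast
    have "L2_set (\<lambda>n. norm (X k n - x n)) F \<le> e" if "N \<le> k" "finite F" for k F
    proof (rule LIMSEQ_le_const2)
      show "(\<lambda>l. L2_set (\<lambda>n. norm (X k n - X l n)) F) \<longlonglongrightarrow> L2_set (\<lambda>n. norm (X k n - x n)) F"
        unfolding L2_set_def by (intro tendsto_intros x)
      have "L2_set (\<lambda>n. norm (X k n - X l n)) F \<le> e" if "N \<le> l" for l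
        using N[OF \<open>N \<le> k\<close> that] L2_set_le_ell2_norm[OF ell2_diff(1)[OF X[of k] X[of l]] \<open>finite F\<close>]
        by linarith
      then show "\<exists>N. \<forall>l\<ge>N. L2_set (\<lambda>n. norm (X k n - X l n)) F \<le> e"
        by blast
    qed
    then show ?thesis
      by (intro exI[of _ N] allI impI conjI) (rule ell2_normI; blast)+
  qed
  have "x \<in> ell2"
  proof -
    obtain k where "(\<lambda>n. X k n - x n) \<in> ell2"
      using lim[of 1] by auto
    then show ?thesis
      using ell2_diff(1)[OF X[of k], of "\<lambda>n. X k n - x n"] by simp
  qed
  moreover have "\<exists>N. \<forall>k\<ge>N. ell2_norm (\<lambda>n. X k n - x n) < e" if "e > 0" for e
    using lim[of "e / 2"] that by fastforce
  ultimately show "\<exists>x. limitin ell2.mtopology X x sequentially"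
    using X by (auto simp: ell2.limit_metric_sequentially)
qed

section \<open>Singular values as extremal stretch factors\<close>

text \<open>
  A null vector of a positive semidefinite form minimizes it, so the first variation
  vanishes there.  The proof moves from \<open>v\<close> against the gradient \<open>w = A v\<close>; the step \<open>t\<close> is
  proportional to \<open>w \<bullet> w\<close> and short enough that the linear decrease beats the quadratic term
  unless \<open>w = 0\<close>.
\<close>
lemma psd_form_zero_imp_kernel:
  fixes A :: "real^'n^'n"
  assumes sym: "transpose A = A"
    and psd: "\<And>x. 0 \<le> x \<bullet> (A *v x)"
    and zero: "v \<bullet> (A *v v) = 0"
  shows "A *v v = 0"
proof -
  define w where "w = A *v v"
  have wv: "v \<bullet> (A *v w) = w \<bullet> w"
    unfolding w_def by (metis sym dot_lmul_matrix transpose_matrix_vector)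
  define a where "a = w \<bullet> (A *v w)"
  have "a \<ge> 0"
    unfolding a_def by (rule psd)
  define t where "t = (w \<bullet> w) / (a + 1)"
  have "t \<ge> 0" and t: "t * (a + 1) = w \<bullet> w"
    using \<open>a \<ge> 0\<close> by (simp_all add: t_def)
  have "0 \<le> (v - t *\<^sub>R w) \<bullet> (A *v (v - t *\<^sub>R w))"
    by (rule psd)
  also have "\<dots> = t\<^sup>2 * a - 2 * t * (w \<bullet> w)"
    using zero wv by (simp add: a_def matrix_vector_mult_diff_distrib matrix_vector_mult_scaleR
        inner_diff_left inner_diff_right power2_eq_square algebra_simps flip: w_def)
  also have "\<dots> = - (t\<^sup>2) * (a + 2)"
    unfolding t[symmetric] by (simp add: power2_eq_square algebra_simps)
  finally have "t\<^sup>2 * (a + 2) \<le> 0"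
    by simp
  then have "t = 0"
    using \<open>a \<ge> 0\<close> by (simp add: mult_le_0_iff)
  then show ?thesis
    using t by (simp flip: w_def)
qed

lemma inner_gram: "x \<bullet> ((transpose A ** A) *v y) = (A *v x) \<bullet> (A *v y)"
  for A :: "real^'n^'m"
  by (metis dot_lmul_matrix inner_commute matrix_vector_mul_assoc transpose_matrix_vector)

text \<open>
  The form \<open>\<bar>A v\<bar>\<^sup>2 \<bar>x\<bar>\<^sup>2 - \<bar>A x\<bar>\<^sup>2\<close> vanishes at \<open>v\<close> and has a fixed sign, so by the previous
  lemma \<open>v\<close> is an eigenvector of the Gram matrix.  The sign \<open>e\<close> is 1 when \<open>v\<close> maximizes the
  stretch and -1 when it minimizes it.
\<close>
lemma extremal_stretch_singular_value:
  fixes A :: "real^'d^'d"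
  assumes "e = 1 \<or> e = (-1 :: real)" and v: "norm v = 1"
    and extremal: "\<And>x. 0 \<le> e * ((norm (A *v v))\<^sup>2 * (norm x)\<^sup>2 - (norm (A *v x))\<^sup>2)"
  shows "norm (A *v v) \<in> singular_values A"
proof -
  define s where "s = norm (A *v v)"
  define B where "B = e *\<^sub>R (s\<^sup>2 *\<^sub>R mat 1 - transpose A ** A)"
  have Bv: "B *v x = e *\<^sub>R (s\<^sup>2 *\<^sub>R x - (transpose A ** A) *v x)" for x
    by (simp add: B_def matrix_vector_mult_diff_rdistrib scaleR_matrix_vector_assoc[symmetric])
  have form: "x \<bullet> (B *v x) = e * (s\<^sup>2 * (norm x)\<^sup>2 - (norm (A *v x))\<^sup>2)" for x
    by (simp add: Bv inner_diff_right inner_gram power2_norm_eq_inner)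
  have "transpose (transpose A ** A) = transpose A ** A"
    by (simp add: matrix_transpose_mul)
  then have "transpose B = B"
    by (simp add: B_def transpose_def vec_eq_iff mat_def)
  moreover have "0 \<le> x \<bullet> (B *v x)" for x
    using extremal[of x] by (simp add: form s_def)
  moreover have "v \<bullet> (B *v v) = 0"
    by (simp add: form v s_def)
  ultimately have "B *v v = 0"
    by (rule psd_form_zero_imp_kernel)
  then have "(transpose A ** A) *v v = s\<^sup>2 *\<^sub>R v"
    using assms(1) by (auto simp: Bv)
  moreover have "v \<noteq> 0"
    using v by auto
  ultimately show ?thesis
    by (auto simp: singular_values_def s_def)
qed

text \<open>
  Eigenvectors of the Gram matrix for different eigenvalues are orthogonal, and a finite-dimensional
  space has only finitely many pairwise orthogonal nonzero vectors.  Finiteness is what makes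
  \<open>Max\<close> and \<open>Min\<close> of the set of singular values meaningful.
\<close>
lemma finite_singular_values: "finite (singular_values (A :: real^'d^'d))"
proof -
  define v where "v s = (SOME v. v \<noteq> 0 \<and> (transpose A ** A) *v v = s\<^sup>2 *\<^sub>R v)" for s
  have v: "v s \<noteq> 0" "(transpose A ** A) *v v s = s\<^sup>2 *\<^sub>R v s" "0 \<le> s"
    if "s \<in> singular_values A" for s
    using that someI_ex[of "\<lambda>v. v \<noteq> 0 \<and> (transpose A ** A) *v v = s\<^sup>2 *\<^sub>R v"]
    unfolding v_def singular_values_def by auto
  have orth: "orthogonal (v s) (v t)"
    if "s \<in> singular_values A" "t \<in> singular_values A" "s \<noteq> t" for s t
  proof -
    have "s\<^sup>2 * (v s \<bullet> v t) = t\<^sup>2 * (v s \<bullet> v t)"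
      using inner_gram[of "v s" A "v t"] inner_gram[of "v t" A "v s"] v that
      by (simp add: inner_commute)
    moreover have "s\<^sup>2 \<noteq> t\<^sup>2"
      using v(3) that by (simp add: power2_eq_iff_nonneg)
    ultimately show ?thesis
      by (simp add: orthogonal_def)
  qed
  have "inj_on v (singular_values A)"
    using orth v(1) by (metis inj_onI orthogonal_self)
  moreover have "finite (v ` singular_values A)"
    using orth by (intro pairwise_orthogonal_imp_finite) (auto simp: pairwise_def)
  ultimately show ?thesis
    by (simp add: finite_image_iff)
qed

text \<open>
  The stretch \<open>\<bar>A x\<bar>\<close> attains its extrema on the compact unit sphere, and the extremal values are
  singular values; homogeneity extends the bounds to all vectors.
\<close>
lemma
  fixes A :: "real^'d^'d"
  shows norm_mult_le_sigma_max: "norm (A *v x) \<le> sigma_max A * norm x"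
    and norm_mult_ge_sigma_min: "sigma_min A * norm x \<le> norm (A *v x)"
    and sigma_max_nonneg: "0 \<le> sigma_max A"
proof -
  have sphere: "compact (sphere (0 :: real^'d) 1)" "sphere (0 :: real^'d) 1 \<noteq> {}"
    by (simp_all add: sphere_empty)
  have cont: "continuous_on (sphere 0 1) (\<lambda>x. norm (A *v x))"
    by (intro continuous_intros matrix_vector_mult_linear_continuous_on)
  have unit: "norm (A *v x) = norm (A *v (x /\<^sub>R norm x)) * norm x"
    "x /\<^sub>R norm x \<in> sphere 0 1" if "x \<noteq> 0" for x
    using that by (simp_all add: matrix_vector_mult_scaleR)
  obtain v where v: "norm v = 1" "\<And>x. norm x = 1 \<Longrightarrow> norm (A *v x) \<le> norm (A *v v)"
    using continuous_attains_sup[OF sphere cont] by auto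
  have le: "norm (A *v x) \<le> norm (A *v v) * norm x" for x
    using unit[of x] v(2)[of "x /\<^sub>R norm x"] by (cases "x = 0") (auto intro: mult_right_mono)
  have "norm (A *v v) \<in> singular_values A"
    using v(1) power_mono[OF le, of _ 2]
    by (intro extremal_stretch_singular_value[of 1]) (simp_all add: power_mult_distrib)
  then have max: "norm (A *v v) \<le> sigma_max A"
    unfolding sigma_max_def by (intro Max_ge finite_singular_values)
  then show "norm (A *v x) \<le> sigma_max A * norm x"
    using le[of x] mult_right_mono[OF max, of "norm x"] by simp
  show "0 \<le> sigma_max A"
    using norm_ge_zero max by (rule order_trans)
  obtain w where w: "norm w = 1" "\<And>x. norm x = 1 \<Longrightarrow> norm (A *v w) \<le> norm (A *v x)"
    using continuous_attains_inf[OF sphere cont] by auto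
  have ge: "norm (A *v w) * norm x \<le> norm (A *v x)" for x
    using unit[of x] w(2)[of "x /\<^sub>R norm x"] by (cases "x = 0") (auto intro: mult_right_mono)
  have "norm (A *v w) \<in> singular_values A"
    using w(1) power_mono[OF ge, of _ 2]
    by (intro extremal_stretch_singular_value[of "-1"]) (simp_all add: power_mult_distrib)
  then have min: "sigma_min A \<le> norm (A *v w)"
    unfolding sigma_min_def by (intro Min_le finite_singular_values)
  then show "sigma_min A * norm x \<le> norm (A *v x)"
    using ge[of x] mult_right_mono[OF min, of "norm x"] by simp
qed

section \<open>Complexified real matrices\<close>

definition cmat :: "real^'n^'m \<Rightarrow> complex^'n^'m" where
  "cmat A = (\<chi> i j. complex_of_real (A $ i $ j))"

text \<open>
  A real matrix acts separately on real and imaginary parts, and the squared norms of the two parts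
  add up.  Hence bounds for the real matrix hold with the same constants for its complexification.
\<close>
lemma cmat_mult_vec:
  "cmat A *v z = (\<chi> j. Complex ((A *v (\<chi> i. Re (z $ i))) $ j) ((A *v (\<chi> i. Im (z $ i))) $ j))"
  by (simp add: vec_eq_iff matrix_vector_mult_def cmat_def complex_eq_iff)

lemma power2_norm_complex_vec:
  "(norm (z :: complex^'n))\<^sup>2 = (norm (\<chi> i. Re (z $ i)))\<^sup>2 + (norm (\<chi> i. Im (z $ i)))\<^sup>2"
  by (simp add: norm_vec_def L2_set_def sum_nonneg cmod_power2 sum.distrib)

lemma Re_Im_cmat:
  "(\<chi> i. Re ((cmat A *v z) $ i)) = A *v (\<chi> i. Re (z $ i))"
  "(\<chi> i. Im ((cmat A *v z) $ i)) = A *v (\<chi> i. Im (z $ i))"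
  by (simp_all add: cmat_mult_vec vec_eq_iff)

lemma norm_cmat_mult_le:
  assumes "\<And>x. norm (A *v x) \<le> c * norm x" "0 \<le> c"
  shows "norm (cmat A *v z) \<le> c * norm z"
proof -
  have "(norm (A *v x))\<^sup>2 \<le> c\<^sup>2 * (norm x)\<^sup>2" for x
    using power_mono[OF assms(1), of x 2] by (simp add: power_mult_distrib)
  then have "(norm (cmat A *v z))\<^sup>2 \<le> (c * norm z)\<^sup>2"
    unfolding power2_norm_complex_vec Re_Im_cmat power_mult_distrib distrib_left
    by (intro add_mono)
  then show ?thesis
    by (rule power2_le_imp_le) (simp add: \<open>0 \<le> c\<close>)
qed

lemma norm_cmat_mult_ge:
  assumes "\<And>x. c * norm x \<le> norm (A *v x)" "0 \<le> c"
  shows "c * norm z \<le> norm (cmat A *v z)"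
proof -
  have "c\<^sup>2 * (norm x)\<^sup>2 \<le> (norm (A *v x))\<^sup>2" for x
    using power_mono[OF assms(1), of x 2] \<open>0 \<le> c\<close> by (simp add: power_mult_distrib)
  then have "(c * norm z)\<^sup>2 \<le> (norm (cmat A *v z))\<^sup>2"
    unfolding power2_norm_complex_vec Re_Im_cmat power_mult_distrib distrib_left
    by (intro add_mono)
  then show ?thesis
    by (rule power2_le_imp_le) simp
qed

lemma cmat_mult: "cmat (A ** B) = cmat A ** cmat B"
  by (simp add: cmat_def matrix_matrix_mult_def vec_eq_iff)

lemma cmat_mat_1: "cmat (mat 1) = mat 1"
  by (simp add: cmat_def mat_def vec_eq_iff)

lemma norm_complex_smult: "norm (c *s (z :: complex^'n)) = cmod c * norm z"
  by (simp add: norm_vec_def norm_mult L2_set_right_distrib)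

section \<open>Bounded operators with an explicit bound\<close>

text \<open>
  Boundedness with the constant exposed, so that the norms of sums of operators can be compared.
  Requiring \<open>0 \<le> C\<close> loses no generality and lets constants be multiplied through inequalities.
\<close>
definition ell2_bounded_by ::
  "((int \<Rightarrow> complex^'d) \<Rightarrow> (int \<Rightarrow> complex^'d)) \<Rightarrow> real \<Rightarrow> bool" where
  "ell2_bounded_by A C \<longleftrightarrow>
     0 \<le> C \<and> (\<forall>\<xi>\<in>ell2. A \<xi> \<in> ell2 \<and> ell2_norm (A \<xi>) \<le> C * ell2_norm \<xi>) \<and>
     (\<forall>\<xi>\<in>ell2. \<forall>\<eta>\<in>ell2. A (\<lambda>n. \<xi> n + \<eta> n) = (\<lambda>n. A \<xi> n + A \<eta> n)) \<and>
     (\<forall>c. \<forall>\<xi>\<in>ell2. A (\<lambda>n. c *s \<xi> n) = (\<lambda>n. c *s A \<xi> n))"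

lemma ell2_bounded_byD:
  assumes "ell2_bounded_by A C"
  shows "0 \<le> C"
    and "\<xi> \<in> ell2 \<Longrightarrow> A \<xi> \<in> ell2"
    and "\<xi> \<in> ell2 \<Longrightarrow> ell2_norm (A \<xi>) \<le> C * ell2_norm \<xi>"
    and "\<xi> \<in> ell2 \<Longrightarrow> \<eta> \<in> ell2 \<Longrightarrow> A (\<lambda>n. \<xi> n + \<eta> n) = (\<lambda>n. A \<xi> n + A \<eta> n)"
    and "\<xi> \<in> ell2 \<Longrightarrow> A (\<lambda>n. c *s \<xi> n) = (\<lambda>n. c *s A \<xi> n)"
  using assms by (auto simp: ell2_bounded_by_def)

lemma bounded_ell2_operator_iff: "bounded_ell2_operator A \<longleftrightarrow> (\<exists>C. ell2_bounded_by A C)"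
proof
  assume A: "bounded_ell2_operator A"
  then obtain C where C: "\<And>\<xi>. \<xi> \<in> ell2 \<Longrightarrow> ell2_norm (A \<xi>) \<le> C * ell2_norm \<xi>"
    unfolding bounded_ell2_operator_def by blast
  have "ell2_norm (A \<xi>) \<le> \<bar>C\<bar> * ell2_norm \<xi>" if "\<xi> \<in> ell2" for \<xi>
    using C[OF that] mult_right_mono[OF abs_ge_self[of C] ell2_norm_nonneg[of \<xi>]] by linarith
  then have "ell2_bounded_by A \<bar>C\<bar>"
    using A by (simp add: bounded_ell2_operator_def ell2_bounded_by_def)
  then show "\<exists>C. ell2_bounded_by A C" ..
next
  assume "\<exists>C. ell2_bounded_by A C"
  then show "bounded_ell2_operator A"
    unfolding bounded_ell2_operator_def ell2_bounded_by_def by blast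
qed

lemma ell2_smult:
  fixes \<xi> :: "int \<Rightarrow> complex^'d"
  assumes "\<xi> \<in> ell2"
  shows "(\<lambda>n. c *s \<xi> n) \<in> ell2" and "ell2_norm (\<lambda>n. c *s \<xi> n) = cmod c * ell2_norm \<xi>"
proof -
  have *: "(\<lambda>n. c *s \<eta> n) \<in> ell2" "ell2_norm (\<lambda>n. c *s \<eta> n) \<le> cmod c * ell2_norm \<eta>"
    if "\<eta> \<in> ell2" for \<eta> :: "int \<Rightarrow> complex^'d" and c
    using ell2_dominated[OF that, of "\<lambda>n. n" "cmod c" "\<lambda>n. c *s \<eta> n"]
    by (simp_all add: norm_complex_smult)
  show "(\<lambda>n. c *s \<xi> n) \<in> ell2"
    using assms by (rule *)
  show "ell2_norm (\<lambda>n. c *s \<xi> n) = cmod c * ell2_norm \<xi>"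
  proof (cases "c = 0")
    case False
    have "ell2_norm \<xi> \<le> inverse (cmod c) * ell2_norm (\<lambda>n. c *s \<xi> n)"
      using *(2)[OF *(1)[OF assms], of "inverse c" c] False
      by (simp add: vector_smult_assoc norm_inverse)
    then show ?thesis
      using *(2)[OF assms, of c] False by (simp add: field_simps)
  qed (simp add: ell2_norm_def)
qed

lemma ell2_bounded_by_diff:
  assumes "ell2_bounded_by A C" "\<xi> \<in> ell2" "\<eta> \<in> ell2"
  shows "A (\<lambda>n. \<xi> n - \<eta> n) = (\<lambda>n. A \<xi> n - A \<eta> n)"
  using ell2_bounded_byD(4)[OF assms(1,2) ell2_smult(1)[OF assms(3), of "-1"]]
    ell2_bounded_byD(5)[OF assms(1,3), of "-1"]
  by (simp add: vector_sneg_minus1[symmetric])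

lemma ell2_bounded_by_add:
  assumes "ell2_bounded_by A a" "ell2_bounded_by B b"
  shows "ell2_bounded_by (\<lambda>\<xi> n. A \<xi> n + B \<xi> n) (a + b)"
proof -
  note A = ell2_bounded_byD[OF assms(1)] and B = ell2_bounded_byD[OF assms(2)]
  have "ell2_norm (\<lambda>n. A \<xi> n + B \<xi> n) \<le> (a + b) * ell2_norm \<xi>" if "\<xi> \<in> ell2" for \<xi>
    using ell2_add(2)[OF A(2)[OF that] B(2)[OF that]] A(3)[OF that] B(3)[OF that]
    by (simp add: distrib_right)
  then show ?thesis
    using A(1) B(1)
    by (auto simp: ell2_bounded_by_def A(2,4,5) B(2,4,5) ell2_add(1) vector_add_ldistrib)
qed

lemma ell2_bounded_by_matrix_shift:
  assumes "\<And>n z. norm (H n *v z) \<le> c * norm z" "0 \<le> c"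
  shows "ell2_bounded_by (\<lambda>\<xi> n. H n *v \<xi> (n + k)) c"
proof -
  have "(\<lambda>n. H n *v \<xi> (n + k)) \<in> ell2"
    "ell2_norm (\<lambda>n. H n *v \<xi> (n + k)) \<le> c * ell2_norm \<xi>" if "\<xi> \<in> ell2" for \<xi>
    using ell2_dominated[OF that, of "\<lambda>n. n + k" c "\<lambda>n. H n *v \<xi> (n + k)"] assms
    by simp_all
  then show ?thesis
    using \<open>0 \<le> c\<close>
    by (simp add: ell2_bounded_by_def matrix_vector_right_distrib vector_scalar_commute)
qed

lemma ell2_bounded_by_smult: "ell2_bounded_by (\<lambda>\<xi> n. c *s \<xi> n) (cmod c)"
  by (auto simp: ell2_bounded_by_def ell2_smult vector_add_ldistrib vector_smult_assoc mult.commute)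

section \<open>Invertibility and perturbation\<close>

text \<open>
  The lower bound makes \<open>A\<close> injective and is, read for preimages, exactly the boundedness of the
  inverse by \<open>1 / c\<close>.
\<close>
lemma ell2_invertibleI:
  assumes A: "ell2_bounded_by A a"
    and below: "\<And>\<xi>. \<xi> \<in> ell2 \<Longrightarrow> c * ell2_norm \<xi> \<le> ell2_norm (A \<xi>)" "0 < c"
    and onto: "\<And>\<eta>. \<eta> \<in> ell2 \<Longrightarrow> \<exists>\<xi>\<in>ell2. A \<xi> = \<eta>"
  shows "ell2_invertible A"
proof -
  define B where "B = inv_into ell2 A"
  have inj: "inj_on A ell2"
  proof (rule inj_onI)
    fix \<xi> \<eta> :: "int \<Rightarrow> complex^'a"
    assume *: "\<xi> \<in> ell2" "\<eta> \<in> ell2" "A \<xi> = A \<eta>"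
    then have "ell2_norm (A (\<lambda>n. \<xi> n - \<eta> n)) = 0"
      by (simp add: ell2_bounded_by_diff[OF A] ell2_norm_def)
    then have "ell2_norm (\<lambda>n. \<xi> n - \<eta> n) = 0"
      using below(1)[OF ell2_diff(1)[OF *(1,2)]] \<open>0 < c\<close>
      by (simp add: mult_le_0_iff order_antisym)
    then show "\<xi> = \<eta>"
      using * by simp
  qed
  have B: "B \<eta> \<in> ell2" "A (B \<eta>) = \<eta>" if "\<eta> \<in> ell2" for \<eta>
  proof -
    have "\<eta> \<in> A ` ell2"
      using onto[OF that] by blast
    then show "B \<eta> \<in> ell2" "A (B \<eta>) = \<eta>"
      unfolding B_def by (rule inv_into_into, rule f_inv_into_f)
  qed
  have BA: "B (A \<xi>) = \<xi>" if "\<xi> \<in> ell2" for \<xi>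
    unfolding B_def using inj that by (rule inv_into_f_f)
  have "ell2_norm (B \<eta>) \<le> inverse c * ell2_norm \<eta>" if "\<eta> \<in> ell2" for \<eta>
    using below(1)[OF B(1)[OF that]] B(2)[OF that] \<open>0 < c\<close> by (simp add: field_simps)
  moreover have "B (\<lambda>n. \<xi> n + \<eta> n) = (\<lambda>n. B \<xi> n + B \<eta> n)"
    if "\<xi> \<in> ell2" "\<eta> \<in> ell2" for \<xi> \<eta>
    using BA[OF ell2_add(1)[OF B(1)[OF that(1)] B(1)[OF that(2)]]] that
    by (simp add: ell2_bounded_byD(4)[OF A] B)
  moreover have "B (\<lambda>n. k *s \<xi> n) = (\<lambda>n. k *s B \<xi> n)" if "\<xi> \<in> ell2" for k \<xi>
    using BA[OF ell2_smult(1)[OF B(1)[OF that]], of k] that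
    by (simp add: ell2_bounded_byD(5)[OF A] B)
  ultimately have "bounded_ell2_operator B"
    unfolding bounded_ell2_operator_def using B(1) by blast
  then show ?thesis
    unfolding ell2_invertible_def using B BA ell2_bounded_byD(2)[OF A] by blast
qed

text \<open>
  Solving \<open>P \<xi> + Q \<xi> = \<eta>\<close> means finding a fixed point of \<open>\<xi> \<mapsto> P\<inverse> (\<eta> - Q \<xi>)\<close>.  This map has
  Lipschitz constant \<open>q / p < 1\<close>, so Banach's fixed point theorem supplies the solution.  The lower
  bound for the sum is the triangle inequality.
\<close>
lemma ell2_invertible_perturbation:
  fixes P Q :: "(int \<Rightarrow> complex^'d) \<Rightarrow> int \<Rightarrow> complex^'d"
  assumes P: "ell2_bounded_by P p'"
    and below: "\<And>\<xi>. \<xi> \<in> ell2 \<Longrightarrow> p * ell2_norm \<xi> \<le> ell2_norm (P \<xi>)"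
    and onto: "\<And>\<eta>. \<eta> \<in> ell2 \<Longrightarrow> \<exists>\<xi>\<in>ell2. P \<xi> = \<eta>"
    and Q: "ell2_bounded_by Q q" and "q < p"
  shows "ell2_invertible (\<lambda>\<xi> n. P \<xi> n + Q \<xi> n)"
proof (rule ell2_invertibleI)
  show "ell2_bounded_by (\<lambda>\<xi> n. P \<xi> n + Q \<xi> n) (p' + q)"
    using P Q by (rule ell2_bounded_by_add)
  show "0 < p - q"
    using \<open>q < p\<close> by simp
next
  fix \<xi> :: "int \<Rightarrow> complex^'d"
  assume \<xi>: "\<xi> \<in> ell2"
  note mem = ell2_bounded_byD(2)[OF P \<xi>] ell2_bounded_byD(2)[OF Q \<xi>]
  have "ell2_norm (P \<xi>) \<le> ell2_norm (\<lambda>n. P \<xi> n + Q \<xi> n) + ell2_norm (Q \<xi>)"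
    using ell2_diff(2)[OF ell2_add(1)[OF mem] mem(2)] by simp
  then show "(p - q) * ell2_norm \<xi> \<le> ell2_norm (\<lambda>n. P \<xi> n + Q \<xi> n)"
    using below[OF \<xi>] ell2_bounded_byD(3)[OF Q \<xi>] by (simp add: left_diff_distrib)
next
  fix \<eta> :: "int \<Rightarrow> complex^'d"
  assume \<eta>: "\<eta> \<in> ell2"
  have "0 \<le> q"
    using Q by (rule ell2_bounded_byD)
  then have "0 < p"
    using \<open>q < p\<close> by simp
  define f where "f \<xi> = inv_into ell2 P (\<lambda>n. \<eta> n - Q \<xi> n)" for \<xi>
  have f: "f \<xi> \<in> ell2" "P (f \<xi>) = (\<lambda>n. \<eta> n - Q \<xi> n)" if "\<xi> \<in> ell2" for \<xi>
  proof -
    have "(\<lambda>n. \<eta> n - Q \<xi> n) \<in> P ` ell2"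
      using onto[OF ell2_diff(1)[OF \<eta> ell2_bounded_byD(2)[OF Q that]]]
      by (metis image_eqI)
    then show "f \<xi> \<in> ell2" "P (f \<xi>) = (\<lambda>n. \<eta> n - Q \<xi> n)"
      unfolding f_def by (rule inv_into_into, rule f_inv_into_f)
  qed
  obtain \<xi> where \<xi>: "\<xi> \<in> ell2" "f \<xi> = \<xi>"
  proof (rule ell2.Banach_fixedpoint_thm[OF ell2_mcomplete, of f "q / p"])
    fix \<xi> \<zeta> :: "int \<Rightarrow> complex^'d"
    assume *: "\<xi> \<in> ell2" "\<zeta> \<in> ell2"
    have "p * ell2_norm (\<lambda>n. f \<xi> n - f \<zeta> n) \<le> ell2_norm (P (\<lambda>n. f \<xi> n - f \<zeta> n))"
      using f(1) * by (intro below ell2_diff(1))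
    also have "P (\<lambda>n. f \<xi> n - f \<zeta> n) = Q (\<lambda>n. \<zeta> n - \<xi> n)"
      using f * by (simp add: ell2_bounded_by_diff[OF P] ell2_bounded_by_diff[OF Q])
    also have "ell2_norm \<dots> \<le> q * ell2_norm (\<lambda>n. \<zeta> n - \<xi> n)"
      using Q * by (intro ell2_bounded_byD(3) ell2_diff(1))
    finally show "ell2_norm (\<lambda>n. f \<xi> n - f \<zeta> n) \<le> q / p * ell2_norm (\<lambda>n. \<xi> n - \<zeta> n)"
      using \<open>0 < p\<close> by (simp add: field_simps ell2_norm_minus_commute[of \<xi>])
  next
    show "(ell2 :: (int \<Rightarrow> complex^'d) set) \<noteq> {}"
      using \<eta> by blast
  qed (use f(1) \<open>0 < p\<close> \<open>q < p\<close> in auto)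
  have "P \<xi> = (\<lambda>n. \<eta> n - Q \<xi> n)"
    using f(2)[OF \<xi>(1)] \<xi>(2) by simp
  then show "\<exists>\<xi>\<in>ell2. (\<lambda>n. P \<xi> n + Q \<xi> n) = \<eta>"
    using \<xi>(1) by (intro bexI[of _ \<xi>]) simp_all
qed

text \<open>
  The perturbation lemma is used twice.  For small \<open>E\<close> the operator \<open>P\<close> dominates
  \<open>Q - E\<close>; for large \<open>E\<close> the multiple \<open>- E\<close> of the identity dominates \<open>P + Q\<close>.
\<close>
lemma ell2_spectrum_in_annulus:
  assumes P: "ell2_bounded_by P p'"
    and below: "\<And>\<xi>. \<xi> \<in> ell2 \<Longrightarrow> p * ell2_norm \<xi> \<le> ell2_norm (P \<xi>)"
    and onto: "\<And>\<eta>. \<eta> \<in> ell2 \<Longrightarrow> \<exists>\<xi>\<in>ell2. P \<xi> = \<eta>"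
    and Q: "ell2_bounded_by Q q"
    and E: "E \<in> ell2_spectrum (\<lambda>\<xi> n. P \<xi> n + Q \<xi> n)"
  shows "p - q \<le> cmod E" and "cmod E \<le> p' + q"
proof -
  note mE = ell2_bounded_by_smult[of "- E"]
  have notinv: "\<not> ell2_invertible (\<lambda>\<xi> n. P \<xi> n + Q \<xi> n - E *s \<xi> n)"
    using E by (simp add: ell2_spectrum_def)
  show "p - q \<le> cmod E"
  proof (rule ccontr)
    assume "\<not> p - q \<le> cmod E"
    then have "ell2_invertible (\<lambda>\<xi> n. P \<xi> n + (Q \<xi> n + (- E) *s \<xi> n))"
      using below onto by (intro ell2_invertible_perturbation[OF P _ _ ell2_bounded_by_add[OF Q mE]]) auto
    then show False
      using notinv by (simp add: algebra_simps)
  qed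
  show "cmod E \<le> p' + q"
  proof (rule ccontr)
    assume less: "\<not> cmod E \<le> p' + q"
    then have "E \<noteq> 0"
      using ell2_bounded_byD(1)[OF P] ell2_bounded_byD(1)[OF Q] by auto
    have "\<exists>\<xi>\<in>ell2. (\<lambda>n. (- E) *s \<xi> n) = \<eta>" if "\<eta> \<in> ell2" for \<eta>
      using ell2_smult(1)[OF that, of "- inverse E"] \<open>E \<noteq> 0\<close>
      by (intro bexI[of _ "\<lambda>n. (- inverse E) *s \<eta> n"]) (simp_all add: vector_smult_assoc)
    then have "ell2_invertible (\<lambda>\<xi> n. (- E) *s \<xi> n + (P \<xi> n + Q \<xi> n))"
      using less
      by (intro ell2_invertible_perturbation[OF mE _ _ ell2_bounded_by_add[OF P Q], of "cmod E"])
        (auto simp: ell2_smult(2) simp del: vector_sneg_minus1)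
    then show False
      using notinv by (simp add: algebra_simps)
  qed
qed

section \<open>The spectrum is non-empty\<close>

text \<open>
  The resolvent \<open>S E\<close> inverts \<open>A - E\<close> for every complex \<open>E\<close>, that is, the spectrum of \<open>A\<close> is
  empty.  For a bounded \<open>A\<close> this is the hypothesis to be refuted.
\<close>
definition is_resolvent ::
  "((int \<Rightarrow> complex^'d) \<Rightarrow> (int \<Rightarrow> complex^'d)) \<Rightarrow>
   (complex \<Rightarrow> (int \<Rightarrow> complex^'d) \<Rightarrow> (int \<Rightarrow> complex^'d)) \<Rightarrow> bool" where
  "is_resolvent A S \<longleftrightarrow> (\<forall>E. bounded_ell2_operator (S E) \<and>
     (\<forall>\<xi>\<in>ell2. S E (\<lambda>n. A \<xi> n - E *s \<xi> n) = \<xi> \<and> (\<lambda>n. A (S E \<xi>) n - E *s S E \<xi> n) = \<xi>))"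

lemma resolventD:
  assumes "is_resolvent A S" "\<xi> \<in> ell2"
  shows "S E \<xi> \<in> ell2" "S E (\<lambda>n. A \<xi> n - E *s \<xi> n) = \<xi>" "A (S E \<xi>) n = \<xi> n + E *s S E \<xi> n"
proof -
  show "S E \<xi> \<in> ell2" "S E (\<lambda>n. A \<xi> n - E *s \<xi> n) = \<xi>"
    using assms by (auto simp: is_resolvent_def bounded_ell2_operator_def)
  have "(\<lambda>n. A (S E \<xi>) n - E *s S E \<xi> n) = \<xi>"
    using assms by (auto simp: is_resolvent_def)
  then show "A (S E \<xi>) n = \<xi> n + E *s S E \<xi> n"
    by (metis add.commute diff_add_cancel)
qed

lemma resolvent_bounded:
  assumes "is_resolvent A S"
  obtains C where "ell2_bounded_by (S E) C"
  using assms by (auto simp: is_resolvent_def bounded_ell2_operator_iff)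

text \<open>
  This is \<open>S E - S E\<^sub>0 = (E - E\<^sub>0) S E S E\<^sub>0\<close>, obtained by applying \<open>S E\<close> to
  \<open>(A - E) \<eta> = \<xi> - (E - E\<^sub>0) \<eta>\<close> with \<open>\<eta> = S E\<^sub>0 \<xi>\<close>.
\<close>
lemma resolvent_identity:
  assumes S: "is_resolvent A S" and \<xi>: "\<xi> \<in> ell2"
  shows "S E \<xi> n - S E\<^sub>0 \<xi> n = (E - E\<^sub>0) *s S E (S E\<^sub>0 \<xi>) n"
proof -
  obtain C where C: "ell2_bounded_by (S E) C"
    using S by (rule resolvent_bounded)
  define \<eta> where "\<eta> = S E\<^sub>0 \<xi>"
  have \<eta>: "\<eta> \<in> ell2" "\<And>n. A \<eta> n = \<xi> n + E\<^sub>0 *s \<eta> n"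
    unfolding \<eta>_def using resolventD[OF S \<xi>] by auto
  have "(\<lambda>n. A \<eta> n - E *s \<eta> n) = (\<lambda>n. \<xi> n - (E - E\<^sub>0) *s \<eta> n)"
    by (simp add: \<eta>(2) vector_sub_rdistrib algebra_simps)
  then have "\<eta> = S E (\<lambda>n. \<xi> n - (E - E\<^sub>0) *s \<eta> n)"
    using resolventD(2)[OF S \<eta>(1), of E] by simp
  also have "\<dots> = (\<lambda>n. S E \<xi> n - (E - E\<^sub>0) *s S E \<eta> n)"
    using \<eta>(1) \<xi> by (simp add: ell2_bounded_by_diff[OF C] ell2_smult(1) ell2_bounded_byD(5)[OF C]
        del: vector_sub_rdistrib)
  finally have "\<eta> n = S E \<xi> n - (E - E\<^sub>0) *s S E \<eta> n"
    by (rule fun_cong)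
  then show ?thesis
    by (simp flip: \<eta>_def)
qed

text \<open>
  Boundedness is known only for each \<open>S E\<close> separately; continuity in \<open>E\<close> needs a bound
  that is uniform near \<open>E\<^sub>0\<close>.  Writing \<open>\<eta> = S E \<xi>\<close> as \<open>S E\<^sub>0 (\<xi> + (E - E\<^sub>0) \<eta>)\<close>, the term in \<open>\<eta>\<close> on
  the right has at most half the norm of \<open>\<eta>\<close> and can be absorbed.
\<close>
lemma resolvent_locally_bounded:
  assumes S: "is_resolvent A S" and \<xi>: "\<xi> \<in> ell2"
    and C: "ell2_bounded_by (S E\<^sub>0) C" and near: "C * cmod (E - E\<^sub>0) \<le> 1 / 2"
  shows "ell2_norm (S E \<xi>) \<le> 2 * C * ell2_norm \<xi>"
proof -
  define \<eta> where "\<eta> = S E \<xi>"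
  have \<eta>: "\<eta> \<in> ell2" "\<And>n. A \<eta> n = \<xi> n + E *s \<eta> n"
    unfolding \<eta>_def using resolventD[OF S \<xi>] by auto
  have "(\<lambda>n. A \<eta> n - E\<^sub>0 *s \<eta> n) = (\<lambda>n. \<xi> n + (E - E\<^sub>0) *s \<eta> n)"
    by (simp add: \<eta>(2) vector_sub_rdistrib algebra_simps)
  then have "\<eta> = S E\<^sub>0 (\<lambda>n. \<xi> n + (E - E\<^sub>0) *s \<eta> n)"
    using resolventD(2)[OF S \<eta>(1), of E\<^sub>0] by simp
  then have "ell2_norm \<eta> \<le> C * ell2_norm (\<lambda>n. \<xi> n + (E - E\<^sub>0) *s \<eta> n)"
    using ell2_bounded_byD(3)[OF C] ell2_add(1)[OF \<xi> ell2_smult(1)[OF \<eta>(1)]] by metis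
  also have "\<dots> \<le> C * (ell2_norm \<xi> + cmod (E - E\<^sub>0) * ell2_norm \<eta>)"
    using ell2_bounded_byD(1)[OF C] ell2_add(2)[OF \<xi> ell2_smult(1)[OF \<eta>(1)]] \<eta>(1)
    by (intro mult_left_mono) (simp_all add: ell2_smult(2) del: vector_sub_rdistrib)
  also have "\<dots> \<le> C * ell2_norm \<xi> + 1 / 2 * ell2_norm \<eta>"
    using mult_right_mono[OF near, of "ell2_norm \<eta>"] by (simp add: algebra_simps)
  finally show ?thesis
    by (simp flip: \<eta>_def)
qed

text \<open>
  By the resolvent identity the increment is \<open>E - E\<^sub>0\<close> times a component of \<open>S E \<eta>\<close> with
  \<open>\<eta> = S E\<^sub>0 \<xi>\<close>, and the local bound controls that component.
\<close>
lemma resolvent_component_continuous: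
  assumes S: "is_resolvent A S" and \<xi>: "\<xi> \<in> ell2"
  shows "isCont (\<lambda>E. S E \<xi> n $ j) E\<^sub>0"
proof -
  obtain C where C: "ell2_bounded_by (S E\<^sub>0) C"
    using S by (rule resolvent_bounded)
  have "0 \<le> C"
    using C by (rule ell2_bounded_byD)
  define \<eta> where "\<eta> = S E\<^sub>0 \<xi>"
  have \<eta>: "\<eta> \<in> ell2"
    unfolding \<eta>_def using S \<xi> by (rule resolventD)
  have near: "\<forall>\<^sub>F E in at E\<^sub>0. C * cmod (E - E\<^sub>0) < 1 / 2"
  proof (rule order_tendstoD(2))
    show "((\<lambda>E. C * cmod (E - E\<^sub>0)) \<longlongrightarrow> C * cmod (E\<^sub>0 - E\<^sub>0)) (at E\<^sub>0)"
      by (intro tendsto_intros)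
  qed simp
  have "\<forall>\<^sub>F E in at E\<^sub>0. norm (S E \<xi> n $ j - S E\<^sub>0 \<xi> n $ j)
      \<le> cmod (E - E\<^sub>0) * (2 * C * ell2_norm \<eta>)"
    using near
  proof eventually_elim
    case (elim E)
    have "S E \<xi> n $ j - S E\<^sub>0 \<xi> n $ j = (E - E\<^sub>0) * S E \<eta> n $ j"
      using resolvent_identity[OF S \<xi>, of E n E\<^sub>0]
      by (metis \<eta>_def vector_minus_component vector_smult_component)
    moreover have "norm (S E \<eta> n $ j) \<le> 2 * C * ell2_norm \<eta>"
      using Finite_Cartesian_Product.norm_nth_le[of "S E \<eta> n" j] norm_le_ell2_norm[OF resolventD(1)[OF S \<eta>], of E n]
        resolvent_locally_bounded[OF S \<eta> C, of E] elim
      by linarith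
    ultimately show ?case
      by (simp add: norm_mult mult_left_mono)
  qed
  moreover have "((\<lambda>E. cmod (E - E\<^sub>0) * (2 * C * ell2_norm \<eta>)) \<longlongrightarrow> 0) (at E\<^sub>0)"
    by (auto intro!: tendsto_eq_intros)
  ultimately have "((\<lambda>E. S E \<xi> n $ j - S E\<^sub>0 \<xi> n $ j) \<longlongrightarrow> 0) (at E\<^sub>0)"
    by (rule Lim_null_comparison)
  then show ?thesis
    unfolding isCont_def by (rule LIM_zero_cancel)
qed

text \<open>
  By the resolvent identity, the difference quotient at \<open>E\<^sub>0\<close> is a component of \<open>S E (S E\<^sub>0 \<xi>)\<close>,
  which depends continuously on \<open>E\<close>.
\<close>
lemma resolvent_component_holomorphic:
  assumes S: "is_resolvent A S" and \<xi>: "\<xi> \<in> ell2"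
  shows "(\<lambda>E. S E \<xi> n $ j) holomorphic_on UNIV"
proof -
  have "((\<lambda>E. S E \<xi> n $ j) has_field_derivative S E\<^sub>0 (S E\<^sub>0 \<xi>) n $ j) (at E\<^sub>0)" for E\<^sub>0
    unfolding CARAT_DERIV
  proof (intro exI conjI allI)
    show "S E \<xi> n $ j - S E\<^sub>0 \<xi> n $ j = S E (S E\<^sub>0 \<xi>) n $ j * (E - E\<^sub>0)" for E
      using resolvent_identity[OF S \<xi>, of E n E\<^sub>0]
      by (metis mult.commute vector_minus_component vector_smult_component)
    show "isCont (\<lambda>E. S E (S E\<^sub>0 \<xi>) n $ j) E\<^sub>0"
      using S resolventD(1)[OF S \<xi>] by (rule resolvent_component_continuous)
  qed simp
  then show ?thesis
    by (auto simp: holomorphic_on_open)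
qed

text \<open>
  If \<open>A \<eta> - E \<eta> = \<xi>\<close> and \<open>A\<close> is bounded by \<open>a\<close>, then \<open>\<bar>E\<bar>\<close> times the norm of \<open>\<eta>\<close> is at most
  \<open>a\<close> times that norm plus the norm of \<open>\<xi>\<close>.
\<close>
lemma resolvent_component_vanishes_at_infinity:
  assumes S: "is_resolvent A S" and \<xi>: "\<xi> \<in> ell2" and A: "ell2_bounded_by A a"
  shows "((\<lambda>E. S E \<xi> n $ j) \<longlongrightarrow> 0) at_infinity"
proof (rule Lim_null_comparison)
  have large: "\<forall>\<^sub>F E in at_infinity. a < cmod E"
    using filterlim_norm_at_top by (auto simp: filterlim_at_top_dense)
  then show "\<forall>\<^sub>F E in at_infinity. norm (S E \<xi> n $ j) \<le> ell2_norm \<xi> / (cmod E - a)"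
  proof eventually_elim
    case (elim E)
    define \<eta> where "\<eta> = S E \<xi>"
    have \<eta>: "\<eta> \<in> ell2" "\<And>n. A \<eta> n = \<xi> n + E *s \<eta> n"
      unfolding \<eta>_def using resolventD[OF S \<xi>] by auto
    have "cmod E * ell2_norm \<eta> = ell2_norm (\<lambda>n. A \<eta> n - \<xi> n)"
      using ell2_smult(2)[OF \<eta>(1), of E] by (simp add: \<eta>(2))
    also have "\<dots> \<le> a * ell2_norm \<eta> + ell2_norm \<xi>"
      using ell2_diff(2)[OF ell2_bounded_byD(2)[OF A \<eta>(1)] \<xi>] ell2_bounded_byD(3)[OF A \<eta>(1)] by simp
    finally have "ell2_norm \<eta> \<le> ell2_norm \<xi> / (cmod E - a)"
      using elim by (simp add: field_simps)
    then show ?case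
      using Finite_Cartesian_Product.norm_nth_le[of "\<eta> n" j] norm_le_ell2_norm[OF \<eta>(1), of n]
      unfolding \<eta>_def by linarith
  qed
  have "filterlim (\<lambda>E. - a + cmod E) at_top at_infinity"
    by (intro filterlim_tendsto_add_at_top[OF tendsto_const] filterlim_norm_at_top)
  then have "filterlim (\<lambda>E. cmod E - a) at_infinity at_infinity"
    by (intro filterlim_at_top_imp_at_infinity) simp
  then show "((\<lambda>E. ell2_norm \<xi> / (cmod E - a)) \<longlongrightarrow> 0) at_infinity"
    by (rule tendsto_divide_0[OF tendsto_const])
qed

text \<open>
  If the spectrum were empty, every component of the resolvent would be entire and vanish at infinity, hence
  be zero by Liouville's theorem; but a resolvent cannot annihilate a nonzero sequence.
\<close>
lemma ell2_spectrum_nonempty: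
  fixes A :: "(int \<Rightarrow> complex^'d) \<Rightarrow> int \<Rightarrow> complex^'d"
  assumes A: "ell2_bounded_by A a"
  shows "ell2_spectrum A \<noteq> {}"
proof
  assume "ell2_spectrum A = {}"
  then have "ell2_invertible (\<lambda>\<xi> n. A \<xi> n - E *s \<xi> n)" for E
    by (auto simp: ell2_spectrum_def)
  then have "\<forall>E. \<exists>B. bounded_ell2_operator B \<and>
      (\<forall>\<xi>\<in>ell2. B (\<lambda>n. A \<xi> n - E *s \<xi> n) = \<xi> \<and> (\<lambda>n. A (B \<xi>) n - E *s B \<xi> n) = \<xi>)"
    by (simp add: ell2_invertible_def)
  then have "\<exists>S. is_resolvent A S"
    unfolding is_resolvent_def by (rule choice)
  then obtain S where S: "is_resolvent A S" ..
  define \<xi> :: "int \<Rightarrow> complex^'d" where "\<xi> n = (if n = 0 then 1 else 0)" for n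
  have "L2_set (\<lambda>n. norm (\<xi> n)) F \<le> norm (\<xi> 0)" if "finite F" for F
    using that by (simp add: \<xi>_def L2_set_def if_distrib[of norm] if_distrib[of "\<lambda>x. x\<^sup>2"] sum.delta cong: if_cong)
  then have \<xi>: "\<xi> \<in> ell2"
    by (rule ell2_normI)
  have "S 0 \<xi> n $ j = 0" for n j
    using resolvent_component_holomorphic[OF S \<xi>]
      resolvent_component_vanishes_at_infinity[OF S \<xi> A] by (rule Liouville_weak_0)
  then have "S 0 \<xi> = (\<lambda>n. 0)"
    by (simp add: fun_eq_iff vec_eq_iff)
  moreover have "A (\<lambda>n. 0) = (\<lambda>n. 0)"
    using ell2_bounded_by_diff[OF A ell2_zero ell2_zero] by simp
  ultimately have "\<xi> 0 = 0"
    using resolventD(3)[OF S \<xi>, of 0 0] by simp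
  then show False
    by (simp add: \<xi>_def)
qed

text \<open>
  A point of the spectrum is needed not only to give \<open>Inf\<close> and \<open>Sup\<close> a meaning but also to make the
  denominator \<open>spec_max A\<close> positive.
\<close>
lemma spec_ratio_ge:
  assumes "ell2_spectrum A \<noteq> {}"
    and annulus: "\<And>E. E \<in> ell2_spectrum A \<Longrightarrow> lo \<le> cmod E \<and> cmod E \<le> hi"
    and "0 < lo"
  shows "lo / hi \<le> spec_min A / spec_max A"
proof -
  have min: "lo \<le> spec_min A"
    unfolding spec_min_def using assms by (intro cINF_greatest) auto
  have max: "spec_max A \<le> hi"
    unfolding spec_max_def using assms by (intro cSUP_least) auto
  obtain E where E: "E \<in> ell2_spectrum A"
    using assms by blast
  have "cmod E \<le> spec_max A"
    unfolding spec_max_def using annulus E by (intro cSUP_upper bdd_aboveI2[where M = hi]) auto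
  then have "0 < spec_max A"
    using annulus[OF E] \<open>0 < lo\<close> by linarith
  then show ?thesis
    using min max \<open>0 < lo\<close> by (intro frac_le) auto
qed

section \<open>The Hessian operator\<close>

definition onsite_op ::
  "(real^'d \<Rightarrow> real) \<Rightarrow> real \<Rightarrow> (int \<Rightarrow> real^'d) \<Rightarrow> (int \<Rightarrow> complex^'d) \<Rightarrow> int \<Rightarrow> complex^'d" where
  "onsite_op V lam u \<xi> n = cmat (lam *\<^sub>R hess V (u n)) *v \<xi> n"

text \<open>
  The part of the Hessian operator that comes from \<open>I\<close>, grouped by bond.  It is written as a sum of four block
  multiplications composed with shifts, so that its norm is at most the sum of four block norms.
\<close>
definition coupling_op ::
  "(real^'d \<Rightarrow> real) \<Rightarrow> (int \<Rightarrow> real^'d) \<Rightarrow> (int \<Rightarrow> complex^'d) \<Rightarrow> int \<Rightarrow> complex^'d" where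
  "coupling_op I u \<xi> n =
     (cmat (hess I (u n - u (n + 1))) *v \<xi> n + cmat (- hess I (u n - u (n + 1))) *v \<xi> (n + 1))
   + (cmat (hess I (u (n - 1) - u n)) *v \<xi> n + cmat (- hess I (u (n - 1) - u n)) *v \<xi> (n - 1))"

lemma uminus_matrix_vector_mult: "(- A) *v x = - (A *v x)"
  for A :: "'a::ring_1^'n^'m"
  by (simp add: matrix_vector_mult_def vec_eq_iff sum_negf)

lemma complexify_hess_op:
  "complexify (hess_op I V lam u) = (\<lambda>\<xi> n. onsite_op V lam u \<xi> n + coupling_op I u \<xi> n)"
  by (auto simp: complexify_def hess_op_def onsite_op_def coupling_op_def cmat_mult_vec fun_eq_iff
      vec_eq_iff complex_eq_iff matrix_vector_mult_add_rdistrib uminus_matrix_vector_mult)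

lemma norm_cmat_scaleR_le:
  "norm (cmat (lam *\<^sub>R A) *v z) \<le> \<bar>lam\<bar> * sigma_max A * norm z"
proof (rule norm_cmat_mult_le)
  show "norm ((lam *\<^sub>R A) *v x) \<le> \<bar>lam\<bar> * sigma_max A * norm x" for x
    using mult_left_mono[OF norm_mult_le_sigma_max[of A x], of "\<bar>lam\<bar>"]
    by (simp add: scaleR_matrix_vector_assoc[symmetric] mult.assoc)
qed (simp add: sigma_max_nonneg)

lemma norm_cmat_scaleR_ge:
  assumes "0 \<le> sigma_min A"
  shows "\<bar>lam\<bar> * sigma_min A * norm z \<le> norm (cmat (lam *\<^sub>R A) *v z)"
proof (rule norm_cmat_mult_ge)
  show "\<bar>lam\<bar> * sigma_min A * norm x \<le> norm ((lam *\<^sub>R A) *v x)" for x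
    using mult_left_mono[OF norm_mult_ge_sigma_min[of A x], of "\<bar>lam\<bar>"]
    by (simp add: scaleR_matrix_vector_assoc[symmetric] mult.assoc)
qed (simp add: assms)

lemma coupling_op_bounded:
  assumes "\<And>n. sigma_max (hess I (u n - u (n + 1))) \<le> c"
  shows "ell2_bounded_by (coupling_op I u) (4 * c)"
proof -
  have c: "0 \<le> c"
    using sigma_max_nonneg assms by (rule order_trans)
  have bound: "norm (cmat (e *\<^sub>R hess I (u n - u (n + 1))) *v z) \<le> c * norm z"
    if "\<bar>e\<bar> = 1" for e n z
    using norm_cmat_scaleR_le[of e "hess I (u n - u (n + 1))" z]
      mult_right_mono[OF assms[of n], of "norm z"] that
    by simp
  have here: "ell2_bounded_by (\<lambda>\<xi> n. cmat (hess I (u n - u (n + 1))) *v \<xi> (n + k)) c"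
      "ell2_bounded_by (\<lambda>\<xi> n. cmat (- hess I (u n - u (n + 1))) *v \<xi> (n + k)) c" for k
    using bound[of 1] bound[of "-1"] c by (auto intro!: ell2_bounded_by_matrix_shift)
  have left: "ell2_bounded_by (\<lambda>\<xi> n. cmat (hess I (u (n - 1) - u n)) *v \<xi> (n + k)) c"
      "ell2_bounded_by (\<lambda>\<xi> n. cmat (- hess I (u (n - 1) - u n)) *v \<xi> (n + k)) c" for k
    using bound[of 1 "n - 1" for n] bound[of "-1" "n - 1" for n] c
    by (auto intro!: ell2_bounded_by_matrix_shift)
  show ?thesis
    using ell2_bounded_by_add[OF ell2_bounded_by_add[OF here(1)[of 0] here(2)[of 1]]
        ell2_bounded_by_add[OF left(1)[of 0] left(2)[of "-1"]]]
    by (simp add: coupling_op_def[abs_def])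
qed

lemma onsite_op_bounded:
  assumes "\<And>n. sigma_max (hess V (u n)) \<le> M" "0 \<le> lam" "0 \<le> M"
  shows "ell2_bounded_by (onsite_op V lam u) (lam * M)"
proof -
  have "norm (cmat (lam *\<^sub>R hess V (u n)) *v z) \<le> lam * M * norm z" for n z
    using norm_cmat_scaleR_le[of lam "hess V (u n)" z] assms
      mult_right_mono[OF mult_left_mono[OF assms(1)[of n] \<open>0 \<le> lam\<close>], of "norm z"]
    by simp
  then show ?thesis
    using ell2_bounded_by_matrix_shift[of "\<lambda>n. cmat (lam *\<^sub>R hess V (u n))" "lam * M" 0] assms
    by (simp add: onsite_op_def[abs_def])
qed

text \<open>
  The lower bound on the singular values makes every block \<open>lam *\<^sub>R hess V (u n)\<close> invertible with
  inverse bounded by \<open>1 / (lam * m)\<close>, uniformly in \<open>n\<close>; uniformity keeps the blockwise preimage of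
  a square-summable sequence square-summable.
\<close>
lemma
  assumes lower: "\<And>n. m \<le> sigma_min (hess V (u n))" and "0 < m" "0 < lam"
  shows onsite_op_bounded_below:
      "onsite_op V lam u \<xi> \<in> ell2 \<Longrightarrow> lam * m * ell2_norm \<xi> \<le> ell2_norm (onsite_op V lam u \<xi>)"
    and onsite_op_onto: "\<eta> \<in> ell2 \<Longrightarrow> \<exists>\<xi>\<in>ell2. onsite_op V lam u \<xi> = \<eta>"
proof -
  have pos: "0 < lam * m"
    using assms by simp
  have ge: "lam * m * norm z \<le> norm (cmat (lam *\<^sub>R hess V (u n)) *v z)" for n z
  proof -
    have "lam * m * norm z \<le> lam * sigma_min (hess V (u n)) * norm z"
      using lower \<open>0 < lam\<close> by (intro mult_right_mono mult_left_mono) auto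
    also have "\<dots> \<le> norm (cmat (lam *\<^sub>R hess V (u n)) *v z)"
      using norm_cmat_scaleR_ge[of "hess V (u n)" lam z] lower[of n] \<open>0 < m\<close> \<open>0 < lam\<close> by simp
    finally show ?thesis .
  qed
  have dom: "norm (\<xi> n) \<le> inverse (lam * m) * norm (onsite_op V lam u \<xi> n)" for \<xi> n
    using ge[of "\<xi> n" n] \<open>0 < m\<close> \<open>0 < lam\<close> by (simp add: onsite_op_def field_simps)
  \<comment> \<open>The blocks are square, so injectivity gives a right inverse.\<close>
  have inv: "\<exists>B. (lam *\<^sub>R hess V (u n)) ** B = mat 1" for n
  proof -
    have "x = 0" if "(lam *\<^sub>R hess V (u n)) *v x = 0" for x
    proof -
      have "m * norm x \<le> 0"
        using norm_mult_ge_sigma_min[of "hess V (u n)" x] mult_right_mono[OF lower[of n], of "norm x"]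
          that \<open>0 < lam\<close> by (simp add: scaleR_matrix_vector_assoc[symmetric])
      then show ?thesis
        using \<open>0 < m\<close> by (simp add: mult_le_0_iff)
    qed
    then show ?thesis
      using matrix_left_invertible_ker[of "lam *\<^sub>R hess V (u n)"] matrix_left_right_inverse by metis
  qed
  show "lam * m * ell2_norm \<xi> \<le> ell2_norm (onsite_op V lam u \<xi>)"
    if "onsite_op V lam u \<xi> \<in> ell2"
    using ell2_dominated(2)[OF that, of "\<lambda>n. n" "inverse (lam * m)" \<xi>] dom[of \<xi>] pos
    by (simp add: field_simps)
  show "\<exists>\<xi>\<in>ell2. onsite_op V lam u \<xi> = \<eta>" if "\<eta> \<in> ell2"
  proof -
    obtain B where B: "\<And>n. (lam *\<^sub>R hess V (u n)) ** B n = mat 1"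
      using inv by metis
    define \<xi> where "\<xi> n = cmat (B n) *v \<eta> n" for n
    have "onsite_op V lam u \<xi> = \<eta>"
      by (simp add: fun_eq_iff onsite_op_def \<xi>_def matrix_vector_mul_assoc flip: cmat_mult)
        (simp add: B cmat_mat_1)
    moreover from this have "\<xi> \<in> ell2"
      using ell2_dominated(1)[OF that, of "\<lambda>n. n" "inverse (lam * m)" \<xi>] dom[of \<xi>]
        \<open>0 < m\<close> \<open>0 < lam\<close> by simp
    ultimately show ?thesis
      by blast
  qed
qed

section \<open>The phonon gap\<close>

theorem theorem4:
  fixes I V :: "real^'d \<Rightarrow> real"
    and Z :: "(real^'d) set"
    and R r m lam M :: real
    and \<rho> u :: "int \<Rightarrow> real^'d"
  assumes "C2 I" and "C2 V"
    and "aubry_criterion (grad V) Z R r m"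
    and "Modules.additive \<rho>"
    and "lam \<ge> (r + R) / (r * m) * K_const I \<rho> (r + R)"
    and "lam \<noteq> 0"
    and "M > 0"
    and "(SUP x\<in>{x. config_dist x \<rho> \<le> ereal (r + R)}. SUP n. ereal (sigma_max (hess V (x n))))
           \<le> ereal M"
    and "equilibrium I V lam u"
    and "(SUP n. INF z\<in>Z. ereal (norm (u n - z))) \<le> ereal r"
    and "config_dist u \<rho> \<le> ereal (r + R)"
    and "\<forall>n. sigma_max (hess I (u n - u (n + 1))) \<le> K_const I \<rho> (r + R) / 4"
    and "\<forall>n. sigma_min (hess V (u n)) \<ge> m"
  shows "phonon_gap I V lam u \<and>
    gap_parameter I V lam u \<ge>
      (lam * m - K_const I \<rho> (r + R)) / (lam * M + K_const I \<rho> (r + R))"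
proof -
  define K where "K = K_const I \<rho> (r + R)"
  let ?A = "complexify (hess_op I V lam u)"
  have pos: "0 < R" "0 < r" "0 < m"
    using assms(3) by (auto simp: aubry_criterion_def)
  have "0 \<le> K"
    using sigma_max_nonneg[of "hess I (u 0 - u (0 + 1))"] assms(12)[rule_format, of 0]
    unfolding K_def by linarith
  have lam: "(r + R) / (r * m) * K \<le> lam"
    using assms(5) by (simp add: K_def)
  moreover have "0 \<le> (r + R) / (r * m) * K"
    using pos \<open>0 \<le> K\<close> by simp
  ultimately have "0 < lam"
    using \<open>lam \<noteq> 0\<close> by linarith
  \<comment> \<open>The factor \<open>(r + R) / r\<close> exceeds 1, so the bound on \<open>lam\<close> is strict after multiplication by
    \<open>m\<close> unless \<open>K\<close> vanishes; for \<open>K = 0\<close> positivity of \<open>lam * m\<close> suffices.\<close>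
  have "K < lam * m"
  proof (cases "K = 0")
    case False
    then have "K < (r + R) / r * K"
      using pos \<open>0 \<le> K\<close> by (simp add: field_simps)
    also have "\<dots> = (r + R) / (r * m) * K * m"
      using pos by simp
    also have "\<dots> \<le> lam * m"
      using lam pos by (intro mult_right_mono) auto
    finally show ?thesis .
  qed (use \<open>0 < lam\<close> pos in simp)
  \<comment> \<open>The configuration \<open>u\<close> is itself one of those over which the supremum is taken.\<close>
  have "sigma_max (hess V (u n)) \<le> M" for n
  proof -
    have "ereal (sigma_max (hess V (u n))) \<le> (SUP n. ereal (sigma_max (hess V (u n))))"
      by (rule SUP_upper) simp
    also have "\<dots> \<le> ereal M"
      using assms(8,11) by (auto simp: SUP_le_iff)
    finally show ?thesis
      by simp
  qed
  then have onsite: "ell2_bounded_by (onsite_op V lam u) (lam * M)"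
    using \<open>0 < lam\<close> \<open>0 < M\<close> by (intro onsite_op_bounded) auto
  have coupling: "ell2_bounded_by (coupling_op I u) K"
    using coupling_op_bounded[of I u "K / 4"] assms(12) by (simp add: K_def)
  have annulus: "lam * m - K \<le> cmod E \<and> cmod E \<le> lam * M + K" if "E \<in> ell2_spectrum ?A" for E
    using ell2_spectrum_in_annulus[OF onsite _ _ coupling, of "lam * m" E] that assms(13)
      pos \<open>0 < lam\<close> onsite_op_bounded_below[of m V u lam] onsite_op_onto[of m V u lam]
      ell2_bounded_byD(2)[OF onsite]
    unfolding complexify_hess_op by blast
  have "phonon_gap I V lam u"
    using annulus[of 0] \<open>K < lam * m\<close> by (auto simp: phonon_gap_def)
  moreover have "ell2_spectrum ?A \<noteq> {}"
    unfolding complexify_hess_op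
    using ell2_bounded_by_add[OF onsite coupling] by (rule ell2_spectrum_nonempty)
  then have "(lam * m - K) / (lam * M + K) \<le> gap_parameter I V lam u"
    unfolding gap_parameter_def using annulus \<open>K < lam * m\<close> by (intro spec_ratio_ge) auto
  ultimately show ?thesis
    by (simp add: K_def)
qed

end
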